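(* Let $f_n(x)=(-1)^{n+1}(1-x^2)^{\lfloor n/2\rfloor}$. Then for every $n\geq 1$: (1) $S_{n+1}(x)=\det(m_{i,j})_{0\leq i,j\leq n}$, a lower Hessenberg determinant of order $n+1$, where $m_{0,0}=x$, $m_{i,0}=x\,S_i(x)$ for $1\leq i\leq n$, $m_{i,j}=\binom{i}{j-1}f_{i-j+1}(x)$ for $1\leq j\leq i\leq n$, $m_{i,i+1}=-1$ for $0\leq i\leq n-1$, and $m_{i,j}=0$ for $j>i+1$. (2) $R_{n+1}(x)=\det(p_{i,j})_{0\leq i,j\leq n-1}$, a lower Hessenberg determinant of order $n$, where $p_{0,0}=2x$, $p_{i,0}=2x\,R_{i+1}(x)$ for $1\leq i\leq n-1$, $p_{i,j}=\binom{i}{j-1}f_{i-j+1}(x)$ for $1\leq j\leq i\leq n-1$, $p_{i,i+1}=-1$ for $0\leq i\leq n-2$, and $p_{i,j}=0$ for $j>i+1$.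
   Context: For $\pi=\pi(1)\cdots\pi(n)$ in the symmetric group $\mathfrak{S}_n$, an alternating run is a maximal segment of consecutive entries (of length at least two) that is increasing or decreasing; $\mathrm{run}(\pi)$ is the number of alternating runs (so $\mathrm{run}=0$ when $n=1$). The type $A$ alternating run polynomials are $R_n(x)=\sum_{\pi\in\mathfrak{S}_n}x^{\mathrm{run}(\pi)}$ for $n\ge 1$ (so $R_1(x)=1$, $R_2(x)=2x$, $R_3(x)=2x+4x^2$). The up-down run polynomials are $S_n(x)=\sum_{\pi\in\mathfrak{S}_n}x^{\mathrm{as}(\pi)}$, where $\mathrm{as}(\pi)$ is the number of alternating runs of the word $0\,\pi(1)\cdots\pi(n)$ (equivalently, the maximal length $k$ of a subsequence with $\pi(i_1)>\pi(i_2)<\pi(i_3)>\cdots\pi(i_k)$, $i_1<\cdots<i_k$); $S_0(x)=1$, $S_1(x)=x$, $S_2(x)=x+x^2$. *)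

theory Defs
  imports
    "HOL-Computational_Algebra.Polynomial"
    "HOL-Combinatorics.Permutations"
    "Jordan_Normal_Form.Determinant"
begin

text \<open>Words are 0-indexed lists; the pair \<open>(i, j)\<close> stands for the segment
  \<open>w ! i, \<dots>, w ! j\<close>. The condition \<open>i < j\<close> says that the segment has length at least two.\<close>

definition monotone_segment :: "nat list \<Rightarrow> nat \<Rightarrow> nat \<Rightarrow> bool" where
  "monotone_segment w i j \<longleftrightarrow> i < j \<and> j < length w \<and>
     (strict_mono_on {i..j} ((!) w) \<or> strict_antimono_on {i..j} ((!) w))"

definition alternating_run :: "nat list \<Rightarrow> nat \<Rightarrow> nat \<Rightarrow> bool" where
  "alternating_run w i j \<longleftrightarrow> monotone_segment w i j \<and>
     (\<forall>i' j'. i' \<le> i \<and> j \<le> j' \<and> monotone_segment w i' j' \<longrightarrow> i' = i \<and> j' = j)"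

definition run :: "nat list \<Rightarrow> nat" where
  "run w = card {(i, j). alternating_run w i j}"

definition one_line :: "nat \<Rightarrow> (nat \<Rightarrow> nat) \<Rightarrow> nat list" where
  "one_line n \<pi> = map \<pi> [1..<Suc n]"

definition run_poly :: "nat \<Rightarrow> int poly" where
  "run_poly n = (\<Sum>\<pi> | \<pi> permutes {1..n}. [:0, 1:] ^ run (one_line n \<pi>))"

definition updown_run_poly :: "nat \<Rightarrow> int poly" where
  "updown_run_poly n = (\<Sum>\<pi> | \<pi> permutes {1..n}. [:0, 1:] ^ run (0 # one_line n \<pi>))"

definition f_poly :: "nat \<Rightarrow> int poly" where
  "f_poly n = (-1) ^ (n + 1) * (1 - [:0, 1:] ^ 2) ^ (n div 2)"

text \<open>The natural-number subtractions in the two matrices below are never truncated, since they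
  only occur for \<open>1 \<le> j \<le> i\<close>.\<close>

definition S_matrix :: "nat \<Rightarrow> int poly mat" where
  "S_matrix n = mat (n + 1) (n + 1) (\<lambda>(i, j).
     if j = 0 then (if i = 0 then [:0, 1:] else [:0, 1:] * updown_run_poly i)
     else if j \<le> i then of_nat (i choose (j - 1)) * f_poly (i - j + 1)
     else if j = i + 1 then -1
     else 0)"

definition R_matrix :: "nat \<Rightarrow> int poly mat" where
  "R_matrix n = mat n n (\<lambda>(i, j).
     if j = 0 then (if i = 0 then 2 * [:0, 1:] else 2 * [:0, 1:] * run_poly (i + 1))
     else if j \<le> i then of_nat (i choose (j - 1)) * f_poly (i - j + 1)
     else if j = i + 1 then -1
     else 0)"

end

theory Submission
  imports Defs "HOL-Combinatorics.Multiset_Permutations"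
    "HOL-Computational_Algebra.Formal_Power_Series"
begin

text \<open>
  Both determinants are solved recurrences: a lower Hessenberg matrix with superdiagonal \<open>-1\<close>
  has determinant \<open>s (n + 1)\<close> when its rows are the coefficients of a recurrence
  \<open>s (i + 1) = (\<Sum>j\<le>i. m i j * s j)\<close> with \<open>s 0 = 1\<close> (\<open>det_lower_hessenberg\<close>). Let
  \<open>C(z) = - (\<Sum>n. f_n z^n / n!)\<close>, \<open>S(z) = \<Sum>n. S_n z^n / n!\<close> and
  \<open>G(z) = \<Sum>n. R_{n+1} z^n / n!\<close>. In terms of these, the two recurrences say
  \<open>S' C = x S\<close> and \<open>G' C = 2 x G\<close>.

  To prove them, put a boundary at each end of a word: nothing, a value below all letters, or a
  value above all letters. Cutting a word at its largest or at its smallest letter \<open>m\<close> makes the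
  runs add up, and each of the two pieces then sees \<open>m\<close> as an extremal boundary of its own
  (\<open>bounded_runs_split\<close>). So the generating functions of the run counts, one for each choice of
  boundaries, satisfy a closed system of differential equations (\<open>weight_egf_deriv\<close>). Let \<open>T\<close>
  belong to the boundaries (low, high) and \<open>U\<close> to (high, high). Cutting at the maximum gives
  \<open>T' = T U\<close>, cutting at the minimum gives \<open>U' = T^2\<close>. Hence \<open>U^2 - T^2\<close> is constant, equal to
  \<open>1 - x^2\<close>. The series \<open>C\<close> satisfies \<open>C'' = (1 - x^2) C\<close>, so \<open>C' + U C\<close> solves \<open>Y' = U Y\<close>
  with \<open>Y(0) = 0\<close> and vanishes; therefore \<open>(T C)' = 0\<close> and \<open>T C = x\<close>
  (\<open>weight_egf_solution\<close>). Cutting at the maximum also gives \<open>S' = T S\<close> and \<open>G = S^2\<close>,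
  whence \<open>S' C = x S\<close> and \<open>G' C = 2 S S' C = 2 x G\<close>.

  Symmetries of words, such as reversal, enter only through these equations: generating functions
  that agree by symmetry satisfy the same linear differential equation with the same initial
  value, and so are equal by \<open>fps_linear_ode_eqI\<close>.
\<close>

section \<open>Counting runs through the pattern of ascents and descents\<close>

definition steps :: "nat list \<Rightarrow> bool list" where
  "steps w = map2 (<) w (tl w)"

fun blocks :: "bool list \<Rightarrow> nat" where
  "blocks [] = 0"
| "blocks [s] = 1"
| "blocks (s # t # p) = (if s = t then 0 else 1) + blocks (t # p)"

lemma length_steps [simp]: "length (steps w) = length w - 1"
  by (simp add: steps_def)

lemma nth_steps: "Suc i < length w \<Longrightarrow> steps w ! i \<longleftrightarrow> w ! i < w ! Suc i"
  by (simp add: steps_def nth_tl)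

lemma steps_Cons: "w \<noteq> [] \<Longrightarrow> steps (x # w) = (x < hd w) # steps w"
  by (cases w) (simp_all add: steps_def)

lemma steps_append:
  "u \<noteq> [] \<Longrightarrow> v \<noteq> [] \<Longrightarrow> steps (u @ v) = steps u @ (last u < hd v) # steps v"
  by (induction u) (auto simp: steps_Cons, auto simp: steps_def)

text \<open>Only relative order matters, so words over any finite set of values can be relabelled to
  words over an initial segment.\<close>

lemma steps_map:
  assumes "strict_mono_on (set w) h"
  shows "steps (map h w) = steps w"
  using assms
proof (induction w)
  case (Cons x w)
  have "(h x < h (hd w)) = (x < hd w)" if "w \<noteq> []"
    using strict_mono_on_less[OF Cons.prems, of x "hd w"] that by simp
  moreover have "steps (map h w) = steps w"
    using Cons by (auto simp: monotone_on_def)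
  ultimately show ?case
    by (cases "w = []") (simp_all add: steps_Cons hd_map, simp add: steps_def)
qed (simp add: steps_def)

lemma blocks_append_same: "blocks (p @ s # s # q) = blocks (p @ s # q)"
  by (induction p rule: blocks.induct) auto

text \<open>A run ends exactly where the direction changes, so cutting there adds the counts.\<close>

lemma blocks_append_change:
  "s \<noteq> t \<Longrightarrow> blocks (p @ s # t # q) = blocks (p @ [s]) + blocks (t # q)"
  by (induction p rule: blocks.induct) auto

lemma blocks_snoc: "blocks (p @ [s]) = blocks p + (if p = [] \<or> last p \<noteq> s then 1 else 0)"
  by (induction p rule: blocks.induct) auto

text \<open>A block is determined by the position at which it starts.\<close>

lemma blocks_eq_card:
  "blocks p = card {i. i < length p \<and> (i = 0 \<or> p ! (i - 1) \<noteq> p ! i)}"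
proof (induction p rule: rev_induct)
  case (snoc s p)
  let ?K = "\<lambda>p :: bool list. {i. i < length p \<and> (i = 0 \<or> p ! (i - 1) \<noteq> p ! i)}"
  have "?K (p @ [s]) = ?K p \<union> (if p = [] \<or> last p \<noteq> s then {length p} else {})"
    by (cases "p = []") (auto simp: nth_append less_Suc_eq last_conv_nth split: if_splits)
  then have "card (?K (p @ [s])) = card (?K p) + (if p = [] \<or> last p \<noteq> s then 1 else 0)"
    by (simp add: card_insert_if)
  then show ?case
    using snoc by (simp add: blocks_snoc)
qed simp

text \<open>Transitivity lifts a comparison of neighbours to the whole interval.\<close>

lemma monotone_on_atLeastAtMost_iff:
  fixes f :: "nat \<Rightarrow> 'a"
  assumes "transp R"
  shows "monotone_on {i..j} (<) R f \<longleftrightarrow> (\<forall>k. i \<le> k \<and> k < j \<longrightarrow> R (f k) (f (Suc k)))"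
proof
  assume R: "\<forall>k. i \<le> k \<and> k < j \<longrightarrow> R (f k) (f (Suc k))"
  have *: "i \<le> k \<Longrightarrow> k + Suc d \<le> j \<Longrightarrow> R (f k) (f (k + Suc d))" for k d
  proof (induction d)
    case (Suc d)
    then have "R (f k) (f (k + Suc d))" "R (f (k + Suc d)) (f (Suc (k + Suc d)))"
      using R by auto
    then show ?case
      using transpD[OF assms] by auto
  qed (use R in auto)
  show "monotone_on {i..j} (<) R f"
  proof (rule monotone_onI)
    fix k l assume "k \<in> {i..j}" "l \<in> {i..j}" "k < l"
    then show "R (f k) (f l)"
      using *[of k "l - k - 1"] by simp
  qed
qed (auto simp: monotone_on_def)

lemma monotone_segment_iff:
  assumes "distinct w"
  shows "monotone_segment w i j \<longleftrightarrow>
    i < j \<and> j < length w \<and> (\<exists>s. \<forall>k. i \<le> k \<and> k < j \<longrightarrow> steps w ! k = s)"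
proof (cases "i < j \<and> j < length w")
  case True
  have up: "strict_mono_on {i..j} ((!) w) \<longleftrightarrow> (\<forall>k. i \<le> k \<and> k < j \<longrightarrow> steps w ! k)"
    using True by (subst monotone_on_atLeastAtMost_iff) (auto simp: nth_steps)
  have "w ! Suc k < w ! k \<longleftrightarrow> \<not> steps w ! k" if "Suc k < length w" for k
    using that assms nth_eq_iff_index_eq[of w k "Suc k"] by (auto simp: nth_steps)
  then have down: "strict_antimono_on {i..j} ((!) w) \<longleftrightarrow> (\<forall>k. i \<le> k \<and> k < j \<longrightarrow> \<not> steps w ! k)"
    using True by (subst monotone_on_atLeastAtMost_iff) (auto intro!: transpI)
  show ?thesis
    unfolding monotone_segment_def up down using True by (simp add: ex_bool_eq)
qed (auto simp: monotone_segment_def)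

text \<open>Maximal monotone segments correspond to maximal constant blocks of the step pattern. Each is
  identified by its left end, which is either \<open>0\<close> or a position where the direction changes.\<close>

lemma run_eq_blocks_steps:
  assumes "distinct w"
  shows "run w = blocks (steps w)"
proof -
  let ?p = "steps w"
  let ?K = "{i. i < length ?p \<and> (i = 0 \<or> ?p ! (i - 1) \<noteq> ?p ! i)}"
  note seg = monotone_segment_iff[OF assms]
  have "bij_betw fst {(i, j). alternating_run w i j} ?K"
  proof (rule bij_betwI')
    fix a b assume ab: "a \<in> {(i, j). alternating_run w i j}" "b \<in> {(i, j). alternating_run w i j}"
    obtain i j i' j' where eq: "a = (i, j)" "b = (i', j')" by fastforce
    have "alternating_run w i j" "alternating_run w i' j'"
      using ab by (simp_all add: eq)
    then have "j = j'" if "i = i'"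
      using that unfolding alternating_run_def by (metis order_refl nat_le_linear)
    then show "(fst a = fst b) = (a = b)"
      by (auto simp: eq)
  next
    fix a assume "a \<in> {(i, j). alternating_run w i j}"
    then obtain i j where a: "a = (i, j)" and run: "alternating_run w i j" by auto
    then have ij: "monotone_segment w i j"
      and max: "\<And>i'. i' \<le> i \<Longrightarrow> monotone_segment w i' j \<Longrightarrow> i' = i"
      by (auto simp: alternating_run_def)
    have "?p ! (i - 1) \<noteq> ?p ! i" if "i \<noteq> 0"
    proof
      assume same: "?p ! (i - 1) = ?p ! i"
      obtain s where s: "\<And>k. i \<le> k \<Longrightarrow> k < j \<Longrightarrow> ?p ! k = s"
        using ij by (auto simp: seg)
      have "?p ! k = s" if "i - 1 \<le> k" "k < j" for k
      proof (cases "k = i - 1")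
        case True
        then show ?thesis using same s[of i] ij by (simp add: seg)
      next
        case False
        then show ?thesis using s that by simp
      qed
      then have "monotone_segment w (i - 1) j"
        using ij unfolding seg by (auto intro: less_imp_diff_less)
      then show False
        using max[of "i - 1"] that by simp
    qed
    then show "fst a \<in> ?K"
      using ij by (auto simp: a seg)
  next
    fix i assume i: "i \<in> ?K"
    define J where "J = {j. monotone_segment w i j}"
    have J: "finite J" "Suc i \<in> J"
    proof -
      show "finite J"
        by (rule finite_subset[of _ "{..length w}"]) (auto simp: J_def seg)
      have "\<exists>s. \<forall>k. i \<le> k \<and> k < Suc i \<longrightarrow> ?p ! k = s"
        by (metis le_antisym less_Suc_eq_le)
      moreover have "Suc i < length w"
        using i by auto
      ultimately show "Suc i \<in> J"
        unfolding J_def mem_Collect_eq seg by blast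
    qed
    then have Max: "Max J \<in> J" "\<And>j. j \<in> J \<Longrightarrow> j \<le> Max J"
      using Max_in[OF J(1)] Max_ge[OF J(1)] J(2) by blast+
    have "i' = i \<and> j' = Max J"
      if le: "i' \<le> i" "Max J \<le> j'" and seg': "monotone_segment w i' j'" for i' j'
    proof -
      have "i < j'"
        using Max(1) le(2) by (auto simp: J_def seg)
      obtain s where const: "\<And>k. i' \<le> k \<Longrightarrow> k < j' \<Longrightarrow> ?p ! k = s"
        using seg' by (auto simp: seg)
      have "i' = i"
      proof (rule ccontr)
        assume "i' \<noteq> i"
        then have "?p ! (i - 1) = ?p ! i"
          using const[of "i - 1"] const[of i] le(1) \<open>i < j'\<close> by auto
        then show False
          using i le(1) \<open>i' \<noteq> i\<close> by auto
      qed
      then show ?thesis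
        using le seg' Max(2)[of j'] by (auto simp: J_def)
    qed
    then have "alternating_run w i (Max J)"
      using Max(1) by (auto simp: alternating_run_def J_def)
    then show "\<exists>a \<in> {(i, j). alternating_run w i j}. i = fst a"
      by force
  qed
  then show ?thesis
    unfolding run_def blocks_eq_card by (rule bij_betw_same_card)
qed

section \<open>Words between two boundaries\<close>

abbreviation end_step :: "bool option \<Rightarrow> bool list" where
  "end_step a \<equiv> (case a of None \<Rightarrow> [] | Some s \<Rightarrow> [s])"

text \<open>The number of runs of a word \<open>w\<close> with a boundary at each end, where a boundary is given by the
  direction of the step that it creates: on the left, \<open>Some True\<close> is a value below all letters and
  \<open>Some False\<close> one above; on the right it is the other way round; \<open>None\<close> is no boundary. Around
  the empty word the two boundaries meet, and they leave one run if they are of opposite heights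
  (equal directions) and none if they have the same height.\<close>

definition bounded_runs :: "bool option \<Rightarrow> nat list \<Rightarrow> bool option \<Rightarrow> nat" where
  "bounded_runs a w b =
    (if w = [] then (if a = b \<and> a \<noteq> None then 1 else 0)
     else blocks (end_step a @ steps w @ end_step b))"

lemma run_eq_bounded_runs:
  assumes "distinct w"
  shows "run w = bounded_runs None w None"
  using assms by (simp add: run_eq_blocks_steps bounded_runs_def) (simp add: steps_def)

lemma run_Cons_eq_bounded_runs:
  assumes "distinct w" "\<And>y. y \<in> set w \<Longrightarrow> x < y"
  shows "run (x # w) = bounded_runs (Some True) w None"
proof (cases "w = []")
  case False
  moreover have "distinct (x # w)" "x < hd w"
    using assms False by auto
  ultimately show ?thesis
    by (simp add: run_eq_blocks_steps bounded_runs_def steps_Cons)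
qed (simp add: run_eq_blocks_steps bounded_runs_def steps_def)

lemma bounded_runs_map:
  assumes "strict_mono_on (set w) h"
  shows "bounded_runs a (map h w) b = bounded_runs a w b"
  by (simp add: bounded_runs_def steps_map[OF assms])

text \<open>The letter \<open>m\<close> is the maximum of the word if \<open>s\<close> holds and the minimum otherwise. One run
  ends and the next one starts at \<open>m\<close>, unless \<open>m\<close> is a free end of the word or is next to a
  boundary on its own side; such a boundary merges with \<open>m\<close>, which the value chosen for the empty
  word takes into account. The condition on the boundaries is there for the one-letter word: if
  \<open>m\<close> has a boundary beyond it on both sides, or on one side with the other side free, then that
  word has two runs or one, but its two parts have none.\<close>

lemma bounded_runs_split:
  assumes u: "\<And>y. y \<in> set u \<Longrightarrow> (y < m) = s"
    and v: "\<And>y. y \<in> set v \<Longrightarrow> (m < y) = (\<not> s)"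
    and ends: "a = Some s \<or> b = Some (\<not> s) \<or> a = None \<and> b = None"
  shows "bounded_runs a (u @ m # v) b =
    bounded_runs a u (Some s) + bounded_runs (Some (\<not> s)) v b"
proof -
  have [simp]: "steps [m] = []"
    by (simp add: steps_def)
  have v': "steps (m # v) = (\<not> s) # steps v" if "v \<noteq> []"
    using that v[of "hd v"] by (simp add: steps_Cons)
  have u': "steps (u @ m # v) = steps u @ s # steps (m # v)" if "u \<noteq> []"
    using that u[of "last u"] by (simp add: steps_append)
  show ?thesis
  proof (cases "u = []"; cases "v = []")
    assume "u \<noteq> []" "v \<noteq> []"
    then show ?thesis
      using blocks_append_change[of s "\<not> s" "end_step a @ steps u" "steps v @ end_step b"]
      by (simp add: bounded_runs_def u' v')
  next
    assume *: "u \<noteq> []" "v = []"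
    then have um: "steps (u @ [m]) = steps u @ [s]"
      using u' by simp
    show ?thesis
    proof (cases b)
      case (Some t)
      then show ?thesis
        using * blocks_append_change[of s t "end_step a @ steps u" "[]"]
          blocks_append_same[of "end_step a @ steps u" s "[]"]
        by (cases "t = s") (auto simp: bounded_runs_def um)
    qed (use * in \<open>simp add: bounded_runs_def um\<close>)
  next
    assume *: "u = []" "v \<noteq> []"
    show ?thesis
    proof (cases a)
      case (Some t)
      then show ?thesis
        using * by (cases "t = s") (auto simp: bounded_runs_def v')
    qed (use * in \<open>simp add: bounded_runs_def v'\<close>)
  next
    assume "u = []" "v = []"
    then show ?thesis
      using ends by (auto simp: bounded_runs_def split: option.split)
  qed
qed


definition run_weight :: "bool option \<Rightarrow> bool option \<Rightarrow> nat \<Rightarrow> int poly" where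
  "run_weight a b n = (\<Sum>w \<in> permutations_of_set {1..n}. [:0, 1:] ^ bounded_runs a w b)"

lemma bij_betw_one_line:
  "bij_betw (one_line n) {\<pi>. \<pi> permutes {1..n}} (permutations_of_set {1..n})"
proof -
  let ?P = "{\<pi>. \<pi> permutes {1..n}}"
  have set: "set [1..<Suc n] = {1..n}" by auto
  have inj: "inj_on (one_line n) ?P"
  proof (rule inj_onI)
    fix \<pi> \<sigma> assume *: "\<pi> \<in> ?P" "\<sigma> \<in> ?P" "one_line n \<pi> = one_line n \<sigma>"
    show "\<pi> = \<sigma>"
    proof
      fix i show "\<pi> i = \<sigma> i"
        using * unfolding one_line_def map_eq_conv set
        by (cases "i \<in> {1..n}") (auto simp: permutes_def)
    qed
  qed
  have sub: "one_line n ` ?P \<subseteq> permutations_of_set {1..n}"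
  proof safe
    fix \<pi> assume \<pi>: "\<pi> permutes {1..n}"
    then have "set (one_line n \<pi>) = {1..n}"
      unfolding one_line_def set_map set by (rule permutes_image)
    moreover have "distinct (one_line n \<pi>)"
      using permutes_inj_on[OF \<pi>] by (simp add: one_line_def distinct_map)
    ultimately show "one_line n \<pi> \<in> permutations_of_set {1..n}"
      by (rule permutations_of_setI)
  qed
  have "one_line n ` ?P = permutations_of_set {1..n}"
    using card_image[OF inj] by (intro card_subset_eq sub) (auto simp: card_permutations)
  then show ?thesis
    using inj by (simp add: bij_betw_def)
qed

lemma run_poly_eq_run_weight: "run_poly n = run_weight None None n"
  unfolding run_poly_def run_weight_def
proof (subst sum.reindex_bij_betw[OF bij_betw_one_line, symmetric], rule sum.cong)
  fix \<pi> assume "\<pi> \<in> {\<pi>. \<pi> permutes {1..n}}"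
  then have "one_line n \<pi> \<in> permutations_of_set {1..n}"
    using bij_betw_apply[OF bij_betw_one_line] by blast
  then show "[:0, 1 :: int:] ^ run (one_line n \<pi>) = [:0, 1:] ^ bounded_runs None (one_line n \<pi>) None"
    by (simp add: run_eq_bounded_runs permutations_of_setD)
qed simp

lemma updown_run_poly_eq_run_weight: "updown_run_poly n = run_weight (Some True) None n"
  unfolding updown_run_poly_def run_weight_def
proof (subst sum.reindex_bij_betw[OF bij_betw_one_line, symmetric], rule sum.cong)
  fix \<pi> assume "\<pi> \<in> {\<pi>. \<pi> permutes {1..n}}"
  then have "one_line n \<pi> \<in> permutations_of_set {1..n}"
    using bij_betw_apply[OF bij_betw_one_line] by blast
  then show "[:0, 1 :: int:] ^ run (0 # one_line n \<pi>) =
      [:0, 1:] ^ bounded_runs (Some True) (one_line n \<pi>) None"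
    by (subst run_Cons_eq_bounded_runs) (auto dest: permutations_of_setD)
qed simp

lemma run_weight_eq_sum:
  assumes "finite A"
  shows "(\<Sum>w \<in> permutations_of_set A. [:0, 1:] ^ bounded_runs a w b) = run_weight a b (card A)"
proof -
  let ?n = "card A"
  obtain h where h: "bij_betw h {..<?n} A" "strict_mono_on {..<?n} h"
    using ex_bij_betw_strict_mono_card[OF assms] .
  \<comment> \<open>\<open>h\<close> enumerates \<open>A\<close> from \<open>0\<close>, whereas the letters of the standard words start at \<open>1\<close>.\<close>
  define g where "g i = h (i - 1)" for i
  have A: "A = g ` {1..?n}"
    using bij_betw_imp_surj_on[OF h(1)]
    by (auto simp: g_def image_image simp flip: atLeast0LessThan
      image_Suc_atLeastLessThan atLeastLessThanSuc_atLeastAtMost)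
  have g: "strict_mono_on {1..?n} g"
    using h(2) by (auto simp: g_def monotone_on_def)
  then have inj: "inj_on g {1..?n}"
    by (rule strict_mono_on_imp_inj_on)
  have "permutations_of_set A = map g ` permutations_of_set {1..?n}"
    using permutations_of_set_image_inj[OF inj] A by simp
  moreover have "inj_on (map g) (permutations_of_set {1..?n})"
    by (rule inj_on_mapI, rule inj_on_subset[OF inj]) (auto simp: permutations_of_set_def)
  moreover have "bounded_runs a (map g w) b = bounded_runs a w b"
    if "w \<in> permutations_of_set {1..?n}" for w
    using that g by (intro bounded_runs_map) (simp add: permutations_of_setD)
  ultimately show ?thesis
    by (simp add: run_weight_def sum.reindex)
qed

lemma sum_Pow_card:
  fixes f :: "nat \<Rightarrow> 'a :: comm_semiring_1"
  assumes "finite A"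
  shows "(\<Sum>B \<in> Pow A. f (card B)) = (\<Sum>k\<le>card A. of_nat (card A choose k) * f k)"
proof -
  have "(\<Sum>B \<in> Pow A. f (card B)) = (\<Sum>k\<le>card A. \<Sum>B \<in> {B \<in> Pow A. card B = k}. f (card B))"
    using assms by (intro sum.group[symmetric]) (auto simp: card_mono)
  also have "\<dots> = (\<Sum>k\<le>card A. of_nat (card A choose k) * f k)"
    using assms by (intro sum.cong) (simp_all flip: n_subsets)
  finally show ?thesis .
qed

text \<open>A permutation of \<open>A\<close> is the same as the set of letters before \<open>m\<close> together with an arrangement
  of that set and one of the remaining letters.\<close>

lemma sum_permutations_of_set_split:
  assumes "finite A" "m \<in> A"
  shows "(\<Sum>w \<in> permutations_of_set A. F w) =
    (\<Sum>B \<in> Pow (A - {m}). \<Sum>u \<in> permutations_of_set B.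
      \<Sum>v \<in> permutations_of_set (A - {m} - B). F (u @ m # v))"
proof -
  let ?S = "SIGMA B : Pow (A - {m}). permutations_of_set B \<times> permutations_of_set (A - {m} - B)"
  have "(\<Sum>w \<in> permutations_of_set A. F w) = (\<Sum>(B, u, v) \<in> ?S. F (u @ m # v))"
  proof (rule sum.reindex_bij_witness[where
      i = "\<lambda>(B, u, v). u @ m # v" and
      j = "\<lambda>w. (set (takeWhile ((\<noteq>) m) w), takeWhile ((\<noteq>) m) w, tl (dropWhile ((\<noteq>) m) w))"])
    fix w assume w: "w \<in> permutations_of_set A"
    then have "m \<in> set w" using assms by (simp add: permutations_of_setD)
    then obtain u v where uv: "w = u @ m # v" "m \<notin> set u"
      by (meson split_list_first)
    then have tw: "takeWhile ((\<noteq>) m) (u @ m # v) = u" "dropWhile ((\<noteq>) m) (u @ m # v) = m # v"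
      by (auto simp: takeWhile_append dropWhile_append)
    show "(case (set (takeWhile ((\<noteq>) m) w), takeWhile ((\<noteq>) m) w, tl (dropWhile ((\<noteq>) m) w)) of
        (B, u, v) \<Rightarrow> u @ m # v) = w"
      by (simp add: uv(1) tw)
    show "(set (takeWhile ((\<noteq>) m) w), takeWhile ((\<noteq>) m) w, tl (dropWhile ((\<noteq>) m) w)) \<in> ?S"
      using w by (auto simp: uv(1) tw permutations_of_set_def)
    show "(case (set (takeWhile ((\<noteq>) m) w), takeWhile ((\<noteq>) m) w, tl (dropWhile ((\<noteq>) m) w)) of
        (B, u, v) \<Rightarrow> F (u @ m # v)) = F w"
      by (simp add: uv(1) tw)
  next
    fix t assume t: "t \<in> ?S"
    then obtain B u v where uv: "t = (B, u, v)" "B \<subseteq> A - {m}"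
      "u \<in> permutations_of_set B" "v \<in> permutations_of_set (A - {m} - B)"
      by auto
    then have u: "m \<notin> set u" "set u = B"
      by (auto simp: permutations_of_set_def)
    then have tw: "takeWhile ((\<noteq>) m) (u @ m # v) = u" "dropWhile ((\<noteq>) m) (u @ m # v) = m # v"
      by (auto simp: takeWhile_append dropWhile_append)
    show "(\<lambda>w. (set (takeWhile ((\<noteq>) m) w), takeWhile ((\<noteq>) m) w, tl (dropWhile ((\<noteq>) m) w)))
        (case t of (B, u, v) \<Rightarrow> u @ m # v) = t"
      by (simp add: uv tw u)
    show "(case t of (B, u, v) \<Rightarrow> u @ m # v) \<in> permutations_of_set A"
      using uv assms(2) by (auto simp: permutations_of_set_def)
  qed
  also have "\<dots> = (\<Sum>B \<in> Pow (A - {m}). \<Sum>u \<in> permutations_of_set B.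
      \<Sum>v \<in> permutations_of_set (A - {m} - B). F (u @ m # v))"
    using assms by (subst sum.Sigma[symmetric]) (auto intro!: sum.cong simp: sum.cartesian_product)
  finally show ?thesis .
qed

text \<open>The recursive structure of the run count. Both \<open>s = True\<close> (cut at the maximum) and
  \<open>s = False\<close> (cut at the minimum) are needed below, because each of them fails for some pairs of
  boundaries.\<close>

lemma run_weight_Suc:
  assumes "a = Some s \<or> b = Some (\<not> s) \<or> a = None \<and> b = None"
  shows "run_weight a b (Suc n) =
    (\<Sum>k\<le>n. of_nat (n choose k) * (run_weight a (Some s) k * run_weight (Some (\<not> s)) b (n - k)))"
proof -
  define A where "A = {1..Suc n}"
  define m where "m = (if s then Suc n else 1)"
  have m: "m \<in> A" "finite A" "card (A - {m}) = n"
    by (auto simp: A_def m_def)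
  have extreme: "(y < m) = s" "(m < y) = (\<not> s)" if "y \<in> A - {m}" for y
    using that by (auto simp: A_def m_def split: if_splits)
  let ?x = "[:0, 1 :: int:]"
  have "(\<Sum>u \<in> permutations_of_set B. \<Sum>v \<in> permutations_of_set (A - {m} - B).
      ?x ^ bounded_runs a (u @ m # v) b) =
    run_weight a (Some s) (card B) * run_weight (Some (\<not> s)) b (n - card B)"
    if B: "B \<in> Pow (A - {m})" for B
  proof -
    have fin: "finite B" "finite (A - {m} - B)"
      using B m by (auto intro: finite_subset)
    have card: "card (A - {m} - B) = n - card B"
      using B m fin by (simp add: card_Diff_subset)
    have split: "bounded_runs a (u @ m # v) b =
        bounded_runs a u (Some s) + bounded_runs (Some (\<not> s)) v b"
      if "u \<in> permutations_of_set B" "v \<in> permutations_of_set (A - {m} - B)" for u v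
    proof (rule bounded_runs_split[OF _ _ assms])
      show "(y < m) = s" if "y \<in> set u" for y
        using that B \<open>u \<in> _\<close> by (intro extreme) (auto simp: permutations_of_set_def)
      show "(m < y) = (\<not> s)" if "y \<in> set v" for y
        using that \<open>v \<in> _\<close> by (intro extreme) (auto simp: permutations_of_set_def)
    qed
    show ?thesis
      unfolding card[symmetric] fin[THEN run_weight_eq_sum, symmetric] sum_product
      by (intro sum.cong) (simp_all add: split power_add)
  qed
  then have "run_weight a b (Suc n) = (\<Sum>B \<in> Pow (A - {m}).
      run_weight a (Some s) (card B) * run_weight (Some (\<not> s)) b (n - card B))"
    unfolding run_weight_def[of a b "Suc n"] A_def[symmetric]
    by (subst sum_permutations_of_set_split[OF m(2,1)]) (rule sum.cong[OF refl])
  also have "\<dots> = (\<Sum>k\<le>n. of_nat (n choose k) *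
      (run_weight a (Some s) k * run_weight (Some (\<not> s)) b (n - k)))"
    by (subst sum_Pow_card) (use m in auto)
  finally show ?thesis .
qed

lemma run_weight_0: "run_weight a b 0 = (if a = b \<and> a \<noteq> None then [:0, 1:] else 1)"
  by (auto simp: run_weight_def bounded_runs_def)

section \<open>Exponential generating functions\<close>

text \<open>The indeterminate of the polynomials is evaluated at an integer \<open>x\<close>, so that the coefficients
  lie in a field and can be divided by factorials. Since a polynomial is determined by its values
  at the integers, no information is lost (\<open>egf_eqD\<close>).\<close>

definition egf :: "int \<Rightarrow> (nat \<Rightarrow> int poly) \<Rightarrow> rat fps" where
  "egf x p = Abs_fps (\<lambda>n. of_int (poly (p n) x) / fact n)"

lemma egf_nth: "fps_nth (egf x p) n = of_int (poly (p n) x) / fact n"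
  by (simp add: egf_def)

lemma fps_deriv_egf: "fps_deriv (egf x p) = egf x (\<lambda>n. p (Suc n))"
  by (rule fps_ext) (simp add: egf_nth del: of_nat_Suc)

lemma egf_mult:
  "egf x p * egf x q = egf x (\<lambda>n. \<Sum>k\<le>n. of_nat (n choose k) * (p k * q (n - k)))"
proof (rule fps_ext)
  fix n
  have "fps_nth (egf x p) k * fps_nth (egf x q) (n - k) =
      of_int (poly (of_nat (n choose k) * (p k * q (n - k))) x) / fact n"
    if "k \<le> n" for k
    using binomial_fact[OF that, where 'a = rat] by (simp add: egf_nth field_simps)
  then have "fps_nth (egf x p * egf x q) n =
      (\<Sum>k\<le>n. of_int (poly (of_nat (n choose k) * (p k * q (n - k))) x) / fact n)"
    by (auto simp: fps_mult_nth atLeast0AtMost intro!: sum.cong)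
  then show "fps_nth (egf x p * egf x q) n =
      fps_nth (egf x (\<lambda>n. \<Sum>k\<le>n. of_nat (n choose k) * (p k * q (n - k)))) n"
    by (simp add: egf_nth poly_sum flip: sum_divide_distrib)
qed

lemma egf_monom_mult: "egf x (\<lambda>n. [:0, 1:] * p n) = fps_const (of_int x) * egf x p"
  by (rule fps_ext) (simp add: egf_nth)

lemma egf_eqD:
  assumes "\<And>x. egf x p = egf x q"
  shows "p n = q n"
proof -
  have "poly (p n) x = poly (q n) x" for x
    using assms[of x, THEN arg_cong[where f = "\<lambda>F. fps_nth F n"]] by (simp add: egf_nth)
  then show ?thesis
    by (simp add: poly_eq_poly_eq_iff[symmetric] fun_eq_iff)
qed

text \<open>Comparing coefficients of \<open>z^m\<close> expresses the coefficient of index \<open>m + 1\<close> of \<open>Y\<close> through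
  earlier ones. The characteristic must be zero to divide by \<open>m + 1\<close>.\<close>

lemma fps_linear_ode_unique:
  fixes Y :: "'a :: {idom, ring_char_0} fps"
  assumes "fps_deriv Y = P * Y" "fps_nth Y 0 = 0"
  shows "Y = 0"
proof (rule fps_ext)
  fix n show "fps_nth Y n = fps_nth 0 n"
  proof (induction n rule: less_induct)
    case (less n)
    show ?case
    proof (cases n)
      case (Suc m)
      have "of_nat (Suc m) * fps_nth Y (Suc m) = fps_nth (P * Y) m"
        by (simp flip: assms(1))
      also have "\<dots> = 0"
        using less Suc by (simp add: fps_mult_nth)
      finally show ?thesis
        unfolding Suc by (simp del: of_nat_Suc)
    qed (use assms in simp)
  qed
qed

lemma fps_linear_ode_eqI:
  fixes Y Z :: "'a :: {idom, ring_char_0} fps"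
  assumes "fps_deriv Y = P * Y" "fps_deriv Z = P * Z" "fps_nth Y 0 = fps_nth Z 0"
  shows "Y = Z"
  using fps_linear_ode_unique[of "Y - Z" P] assms by (simp add: algebra_simps)

abbreviation weight_egf :: "int \<Rightarrow> bool option \<Rightarrow> bool option \<Rightarrow> rat fps" where
  "weight_egf x a b \<equiv> egf x (run_weight a b)"

lemma weight_egf_0:
  "fps_nth (weight_egf x a b) 0 = (if a = b \<and> a \<noteq> None then of_int x else 1)"
  by (cases a; cases b) (simp_all add: egf_nth run_weight_0)

lemma weight_egf_deriv:
  assumes "a = Some s \<or> b = Some (\<not> s) \<or> a = None \<and> b = None"
  shows "fps_deriv (weight_egf x a b) = weight_egf x a (Some s) * weight_egf x (Some (\<not> s)) b"
  unfolding fps_deriv_egf egf_mult run_weight_Suc[OF assms] ..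

text \<open>Reading words backwards exchanges the boundaries (high, low) and (low, high).\<close>

lemma weight_egf_reverse:
  "weight_egf x (Some False) (Some False) = weight_egf x (Some True) (Some True)"
proof (rule fps_linear_ode_eqI[where P = "weight_egf x (Some False) (Some True)"])
qed (use weight_egf_deriv[of "Some True" True "Some True" x]
  weight_egf_deriv[of "Some False" True "Some False" x]
  in \<open>simp_all add: weight_egf_0 mult.commute\<close>)

text \<open>The second factor is \<open>C(z) = cosh (q z) - sinh (q z) / q\<close> with \<open>q^2 = 1 - x^2\<close>. The proof
  avoids the square root and division by power series: what it uses of \<open>C\<close> is \<open>C'' = q^2 C\<close>,
  \<open>C(0) = 1\<close> and \<open>C'(0) = -1\<close>.\<close>

lemma weight_egf_solution:
  "weight_egf x (Some True) (Some True) * egf x (\<lambda>n. - f_poly n) = fps_const (of_int x)"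
proof -
  define T where "T = weight_egf x (Some True) (Some True)"
  define U where "U = weight_egf x (Some False) (Some True)"
  define C where "C = egf x (\<lambda>n. - f_poly n)"
  define r :: "rat fps" where "r = fps_const (1 - of_int x ^ 2)"
  have deriv: "fps_deriv T = U * T" "fps_deriv U = T ^ 2"
    using weight_egf_deriv[of "Some True" True "Some True" x]
      weight_egf_deriv[of "Some False" False "Some True" x]
    by (simp_all add: T_def U_def weight_egf_reverse power2_eq_square mult.commute)
  have init: "fps_nth T 0 = of_int x" "fps_nth U 0 = 1"
    by (simp_all add: T_def U_def weight_egf_0)
  have "fps_deriv (U ^ 2 - T ^ 2) = 0"
    using deriv by (simp add: power2_eq_square algebra_simps)
  then have "U ^ 2 - T ^ 2 = fps_const (fps_nth (U ^ 2 - T ^ 2) 0)"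
    by (simp only: fps_deriv_eq_0_iff)
  then have U_T: "U ^ 2 - T ^ 2 = r"
    by (simp add: init r_def fps_power_zeroth)
  have C_0: "fps_nth C 0 = 1" "fps_nth (fps_deriv C) 0 = -1"
    by (simp_all add: C_def egf_nth f_poly_def)
  have C_deriv: "fps_deriv (fps_deriv C) = r * C"
    by (rule fps_ext) (simp add: C_def r_def fps_deriv_egf egf_nth f_poly_def del: fps_deriv_nth)
  define P where "P = fps_deriv C + U * C"
  have "fps_deriv P = U * P"
  proof -
    have "fps_deriv P = (r + T ^ 2) * C + U * fps_deriv C"
      using deriv by (simp add: P_def C_deriv power2_eq_square algebra_simps)
    also have "r + T ^ 2 = U ^ 2"
      using U_T by (simp add: algebra_simps)
    finally show ?thesis
      by (simp add: P_def power2_eq_square algebra_simps)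
  qed
  moreover have "fps_nth P 0 = 0"
    using C_0 init by (simp add: P_def)
  ultimately have "P = 0"
    by (rule fps_linear_ode_unique)
  have "fps_deriv (T * C) = T * P"
    using deriv by (simp add: P_def algebra_simps)
  then have "fps_deriv (T * C) = 0"
    using \<open>P = 0\<close> by simp
  then have "T * C = fps_const (fps_nth (T * C) 0)"
    by (simp only: fps_deriv_eq_0_iff)
  then show ?thesis
    using C_0 init by (simp add: T_def C_def)
qed

text \<open>By complementing and reversing words, it does not matter which end carries the single boundary
  or whether that boundary is low or high. Here \<open>?L\<close> and \<open>?H\<close> have a low or high boundary on the
  left, and \<open>?L'\<close> and \<open>?H'\<close> on the right. Their equations are coupled in pairs
  \<open>Y' = T Z\<close>, \<open>Z' = T Y\<close> with equal initial values, so each difference solves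
  \<open>D' = - T D\<close> with \<open>D(0) = 0\<close>.\<close>

lemma weight_egf_free_end:
  "weight_egf x (Some False) None = weight_egf x (Some True) None" (is "?H = ?L")
  "weight_egf x None (Some True) = weight_egf x (Some True) None" (is "?H' = ?L")
proof -
  let ?T = "weight_egf x (Some True) (Some True)"
  let ?L' = "weight_egf x None (Some False)"
  have deriv: "fps_deriv ?L = ?T * ?H" "fps_deriv ?H = ?T * ?L"
      "fps_deriv ?H' = ?T * ?L'" "fps_deriv ?L' = ?T * ?H'"
    using weight_egf_deriv[of "Some True" True None x]
      weight_egf_deriv[of "Some False" False None x]
      weight_egf_deriv[of None False "Some True" x]
      weight_egf_deriv[of None True "Some False" x]
    by (simp_all add: weight_egf_reverse mult.commute)
  have "?H - ?L = 0"
    using deriv by (intro fps_linear_ode_unique[of _ "- ?T"]) (simp_all add: weight_egf_0 algebra_simps)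
  then show "?H = ?L" by simp
  have "?H' - ?L' = 0"
    using deriv by (intro fps_linear_ode_unique[of _ "- ?T"]) (simp_all add: weight_egf_0 algebra_simps)
  then show "?H' = ?L"
    using deriv \<open>?H = ?L\<close>
    by (intro fps_linear_ode_eqI[of ?H' ?T ?L]) (simp_all add: weight_egf_0)
qed

text \<open>Cut the word with the prefixed \<open>0\<close> at its maximum: the left part lies between a low and a high
  boundary, and the right part has a single high boundary, which is as good as a low one.\<close>

lemma fps_deriv_updown_run_egf:
  "fps_deriv (egf x updown_run_poly) =
    weight_egf x (Some True) (Some True) * egf x updown_run_poly"
  using weight_egf_deriv[of "Some True" True None x]
  by (simp add: weight_egf_free_end updown_run_poly_eq_run_weight[abs_def])

lemma updown_run_poly_recurrence:
  "(\<Sum>k\<le>n. of_nat (n choose k) * (updown_run_poly (Suc k) * - f_poly (n - k))) =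
    [:0, 1:] * updown_run_poly n"
proof (rule egf_eqD[where n = n])
  fix x
  let ?S = "egf x updown_run_poly" and ?C = "egf x (\<lambda>n. - f_poly n)"
  let ?T = "weight_egf x (Some True) (Some True)"
  have "fps_deriv ?S * ?C = (?T * ?C) * ?S"
    by (simp add: fps_deriv_updown_run_egf ac_simps)
  then have "fps_deriv ?S * ?C = fps_const (of_int x) * ?S"
    by (simp only: weight_egf_solution)
  then show "egf x (\<lambda>n. \<Sum>k\<le>n. of_nat (n choose k) * (updown_run_poly (Suc k) * - f_poly (n - k))) =
      egf x (\<lambda>n. [:0, 1:] * updown_run_poly n)"
    by (simp only: fps_deriv_egf egf_mult egf_monom_mult)
qed

text \<open>Cutting at the maximum leaves two words with one boundary each, so the series of the
  \<open>R_{n+1}\<close> is the square of the series of the \<open>S_n\<close>. This is why the two recurrences differ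
  only by the factor \<open>2\<close>.\<close>

lemma run_poly_recurrence:
  "(\<Sum>k\<le>n. of_nat (n choose k) * (run_poly (Suc (Suc k)) * - f_poly (n - k))) =
    [:0, 1:] * (2 * run_poly (Suc n))"
proof (rule egf_eqD[where n = n])
  fix x
  let ?S = "egf x updown_run_poly" and ?C = "egf x (\<lambda>n. - f_poly n)"
  let ?G = "egf x (\<lambda>n. run_poly (Suc n))"
  let ?T = "weight_egf x (Some True) (Some True)"
  have G: "?G = ?S * ?S"
    using weight_egf_deriv[of None True None x]
    by (simp add: weight_egf_free_end updown_run_poly_eq_run_weight[abs_def]
      run_poly_eq_run_weight[abs_def] fps_deriv_egf)
  have "fps_deriv ?G * ?C = (?T * ?C) * (2 * ?G)"
    by (simp add: G fps_deriv_updown_run_egf algebra_simps)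
  then have "fps_deriv ?G * ?C = fps_const (of_int x) * (2 * ?G)"
    by (simp only: weight_egf_solution)
  moreover have "2 * ?G = egf x (\<lambda>n. 2 * run_poly (Suc n))"
    by (rule fps_ext) (simp add: egf_nth numeral_fps_const)
  ultimately show "egf x (\<lambda>n. \<Sum>k\<le>n. of_nat (n choose k) *
        (run_poly (Suc (Suc k)) * - f_poly (n - k))) =
      egf x (\<lambda>n. [:0, 1:] * (2 * run_poly (Suc n)))"
    by (simp only: fps_deriv_egf egf_mult egf_monom_mult)
qed

section \<open>Lower Hessenberg determinants\<close>

text \<open>The recurrence says that the rows of the matrix annihilate the vector of the values of \<open>s\<close>, except
  that the last row gives \<open>s (n + 1)\<close>. So multiplying on the right by the unit lower triangular
  matrix whose first column is that vector clears the first column except for its last entry; the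
  complementary minor is triangular with diagonal entries \<open>-1\<close>, and its sign cancels the sign of
  the cofactor.\<close>

lemma det_lower_hessenberg:
  fixes m :: "nat \<Rightarrow> nat \<Rightarrow> 'a :: comm_ring_1"
  assumes s_0: "s 0 = 1"
    and s_Suc: "\<And>i. i \<le> n \<Longrightarrow> s (Suc i) = (\<Sum>j\<le>i. m i j * s j)"
  shows "det (mat (Suc n) (Suc n)
    (\<lambda>(i, j). if j \<le> i then m i j else if j = i + 1 then -1 else 0)) = s (Suc n)"
proof -
  let ?h = "\<lambda>i j. if j \<le> i then m i j else if j = i + 1 then -1 else 0"
  define M where "M = mat (Suc n) (Suc n) (\<lambda>(i, j). ?h i j)"
  define V where "V = mat (Suc n) (Suc n) (\<lambda>(i, j). if j = 0 then s i else if i = j then 1 else 0)"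
  define L where "L = mat (Suc n) (Suc n)
    (\<lambda>(i, j). if j = 0 then (if i = n then s (Suc n) else 0) else ?h i j)"
  have carrier: "M \<in> carrier_mat (Suc n) (Suc n)" "V \<in> carrier_mat (Suc n) (Suc n)"
      "L \<in> carrier_mat (Suc n) (Suc n)"
    by (simp_all add: M_def V_def L_def)
  have first: "(\<Sum>k<Suc n. ?h i k * s k) = (if i = n then s (Suc n) else 0)" if "i \<le> n" for i
  proof -
    have "(\<Sum>k<Suc n. ?h i k * s k) = (\<Sum>k\<in>{..i} \<union> (if i = n then {} else {Suc i}). ?h i k * s k)"
      using that by (intro sum.mono_neutral_right) auto
    also have "\<dots> = (\<Sum>k\<le>i. m i k * s k) - (if i = n then 0 else s (Suc i))"
      by (subst sum.union_disjoint) auto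
    finally show ?thesis
      using s_Suc[OF that] by (auto simp del: sum.lessThan_Suc)
  qed
  have "M * V = L"
  proof (rule eq_matI)
    fix i j assume "i < dim_row L" "j < dim_col L"
    then have ij: "i \<le> n" "j \<le> n" by (simp_all add: L_def)
    have "(M * V) $$ (i, j) = (\<Sum>k<Suc n. ?h i k * (if j = 0 then s k else if k = j then 1 else 0))"
      using ij by (simp add: M_def V_def scalar_prod_def atLeast0LessThan)
    also have "\<dots> = L $$ (i, j)"
    proof (cases "j = 0")
      case True
      then show ?thesis
        using first[OF ij(1)] ij by (simp add: L_def)
    next
      case False
      then have "(\<Sum>k<Suc n. ?h i k * (if j = 0 then s k else if k = j then 1 else 0)) =
          (\<Sum>k<Suc n. if k = j then ?h i k else 0)"
        by (intro sum.cong) auto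
      also have "\<dots> = ?h i j"
        using ij by (subst sum.delta) auto
      finally show ?thesis
        using False ij by (simp add: L_def)
    qed
    finally show "(M * V) $$ (i, j) = L $$ (i, j)" .
  qed (simp_all add: M_def V_def L_def)
  moreover have "det V = 1"
    using s_0 by (subst det_lower_triangular[OF _ carrier(2)])
      (auto simp: V_def prod_list_diag_prod intro!: prod.neutral)
  ultimately have "det M = det L"
    using det_mult[OF carrier(1,2)] by simp
  also have "\<dots> = (\<Sum>i<Suc n. L $$ (i, 0) * cofactor L i 0)"
    by (rule laplace_expansion_column[OF carrier(3)]) simp
  also have "\<dots> = (\<Sum>i<Suc n. if i = n then s (Suc n) * cofactor L n 0 else 0)"
    by (rule sum.cong) (auto simp: L_def)
  also have "\<dots> = s (Suc n) * cofactor L n 0"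
    by simp
  also have "cofactor L n 0 = 1"
  proof -
    have "mat_delete L n 0 = mat n n (\<lambda>(i, j). ?h i (Suc j))"
      by (rule eq_matI) (auto simp: mat_delete_def L_def)
    also have "det \<dots> = (-1) ^ n"
      by (subst det_lower_triangular[of n]) (auto simp: prod_list_diag_prod)
    finally show ?thesis
      by (simp add: cofactor_def flip: power_add)
  qed
  finally show ?thesis
    by (simp add: M_def)
qed

text \<open>As \<open>f_0 = -1\<close>, the term \<open>k = i\<close> of the convolution is \<open>s (i + 1)\<close> itself. Solving for it puts the
  convolution into the form of a recurrence whose coefficients are the matrix entries.\<close>

lemma det_binomial_hessenberg:
  assumes s_0: "s 0 = 1"
    and recurrence: "\<And>i. (\<Sum>k\<le>i. of_nat (i choose k) * (s (Suc k) * - f_poly (i - k))) = c * s i"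
  shows "det (mat (Suc n) (Suc n) (\<lambda>(i, j).
      if j = 0 then c * s i
      else if j \<le> i then of_nat (i choose (j - 1)) * f_poly (i - j + 1)
      else if j = i + 1 then -1
      else 0)) = s (Suc n)"
proof -
  define m where "m i j = (if j = 0 then c * s i
      else of_nat (i choose (j - 1)) * f_poly (i - j + 1))" for i j
  have "s (Suc i) = (\<Sum>j\<le>i. m i j * s j)" for i
  proof -
    have "(\<Sum>j\<le>i. m i j * s j) =
        c * s i + (\<Sum>k<i. of_nat (i choose k) * f_poly (i - k) * s (Suc k))"
      unfolding lessThan_Suc_atMost[symmetric] sum.lessThan_Suc_shift
      using s_0 by (intro arg_cong2[where f = "(+)"] sum.cong) (auto simp: m_def Suc_diff_Suc)
    also have "c * s i = s (Suc i) - (\<Sum>k<i. of_nat (i choose k) * f_poly (i - k) * s (Suc k))"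
      unfolding recurrence[symmetric] lessThan_Suc_atMost[symmetric]
      by (simp add: f_poly_def sum_negf ac_simps)
    finally show ?thesis by simp
  qed
  then have "det (mat (Suc n) (Suc n)
      (\<lambda>(i, j). if j \<le> i then m i j else if j = i + 1 then -1 else 0)) = s (Suc n)"
    using s_0 by (intro det_lower_hessenberg)
  also have "mat (Suc n) (Suc n)
      (\<lambda>(i, j). if j \<le> i then m i j else if j = i + 1 then -1 else 0) =
    mat (Suc n) (Suc n) (\<lambda>(i, j).
      if j = 0 then c * s i
      else if j \<le> i then of_nat (i choose (j - 1)) * f_poly (i - j + 1)
      else if j = i + 1 then -1
      else 0)"
    by (rule eq_matI) (auto simp: m_def)
  finally show ?thesis .
qed

theorem theorem13:
  fixes n :: nat
  assumes "n \<ge> 1"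
  shows "updown_run_poly (n + 1) = det (S_matrix n) \<and>
         run_poly (n + 1) = det (R_matrix n)"
proof
  have S_0: "updown_run_poly 0 = 1"
    by (simp add: updown_run_poly_eq_run_weight run_weight_0)
  have R_1: "run_poly (Suc 0) = 1"
    by (simp add: run_poly_eq_run_weight run_weight_Suc[of _ True] run_weight_0)
  have "S_matrix n = mat (Suc n) (Suc n) (\<lambda>(i, j).
      if j = 0 then [:0, 1:] * updown_run_poly i
      else if j \<le> i then of_nat (i choose (j - 1)) * f_poly (i - j + 1)
      else if j = i + 1 then -1
      else 0)"
    by (rule eq_matI) (auto simp: S_matrix_def S_0)
  then show "updown_run_poly (n + 1) = det (S_matrix n)"
    using det_binomial_hessenberg[of updown_run_poly, OF S_0 updown_run_poly_recurrence] by simp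
  \<comment> \<open>The matrix for the run polynomials solves the recurrence for the shifted sequence
    \<open>R_{i+1}\<close>, so its order is smaller by one than that of the other matrix.\<close>
  obtain n' where n: "n = Suc n'"
    using assms by (cases n) auto
  have "R_matrix n = mat (Suc n') (Suc n') (\<lambda>(i, j).
      if j = 0 then 2 * [:0, 1:] * run_poly (Suc i)
      else if j \<le> i then of_nat (i choose (j - 1)) * f_poly (i - j + 1)
      else if j = i + 1 then -1
      else 0)"
    by (rule eq_matI) (auto simp: R_matrix_def R_1 n)
  then show "run_poly (n + 1) = det (R_matrix n)"
    using det_binomial_hessenberg[of "\<lambda>i. run_poly (Suc i)" "2 * [:0, 1:]" n'] R_1 run_poly_recurrence n
    by (simp add: mult.left_commute)
qed

end
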